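(* Let $\langle d,k,m\rangle\in M_n\setminus\{\mathbf{0}\}$. If $d=0$ then $\langle d,k,m\rangle$ is idempotent; if $d\ne 0$ then it is nilpotent, and its nilpotency index $\ell$ (the smallest $j\in\mathbb{N}$ with $\langle d,k,m\rangle^j=\mathbf{0}$) is $$\ell=1+\left\lceil\frac{m-k+1}{|d|}\right\rceil,$$ and satisfies $2\le\ell\le n$.
   Context: Fix an integer $n\ge 2$. For integers $d,k,m$ with $1-\min(0,d)\le k\le m\le n-\max(0,d)$, let $\langle d,k,m\rangle$ denote the $n\times n$ matrix with entries $x_{ij}$ ($i,j\in\{1,\dots,n\}$) equal to $1$ if $k\le i\le m$ and $j-i=d$, and $0$ otherwise (it has $m-k+1$ ones). Let $\mathbf{0}$ be the $n\times n$ zero matrix and $M_n=\{\mathbf{0}\}\cup\{\langle d,k,m\rangle: d\in\mathbb{Z},\ k,m\in\mathbb{N},\ 1-\min(0,d)\le k\le m\le n-\max(0,d)\}$, a monoid under matrix multiplication. $\lceil t\rceil$ is the ceiling of $t$. *)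

theory Defs
  imports Complex_Main "Jordan_Normal_Form.Matrix"
begin

definition diag_params :: "nat \<Rightarrow> int \<Rightarrow> nat \<Rightarrow> nat \<Rightarrow> bool" where
  "diag_params n d k m \<longleftrightarrow>
     1 - min 0 d \<le> int k \<and> k \<le> m \<and> int m \<le> int n - max 0 d"

text \<open>
  Matrices of type \<^typ>\<open>'a mat\<close> have row and column indices starting at 0, so the entry
  in row \<open>i\<close> and column \<open>j\<close> below is the entry with indices \<open>i + 1\<close> and \<open>j + 1\<close> in the
  numbering by \<open>1, \<dots>, n\<close>. The shift cancels in the condition \<open>j - i = d\<close>.
\<close>

definition diag_segment :: "nat \<Rightarrow> int \<Rightarrow> nat \<Rightarrow> nat \<Rightarrow> 'a :: semiring_1 mat" where
  "diag_segment n d k m =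
     mat n n (\<lambda>(i, j). if k \<le> i + 1 \<and> i + 1 \<le> m \<and> int j - int i = d then 1 else 0)"

definition diag_monoid :: "nat \<Rightarrow> 'a :: semiring_1 mat set" where
  "diag_monoid n = {0\<^sub>m n n} \<union> {diag_segment n d k m | d k m. diag_params n d k m}"

definition idempotent_mat :: "'a :: semiring_1 mat \<Rightarrow> bool" where
  "idempotent_mat A \<longleftrightarrow> A * A = A"

definition nilpotent_mat :: "'a :: semiring_1 mat \<Rightarrow> bool" where
  "nilpotent_mat A \<longleftrightarrow> (\<exists>j. A ^\<^sub>m j = 0\<^sub>m (dim_row A) (dim_col A))"

text \<open>
  The exponent 0 is harmless here and in \<^const>\<open>nilpotent_mat\<close>: the zeroth power is the
  identity matrix, which is nonzero as soon as there is at least one row.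
\<close>

definition nilpotency_index :: "'a :: semiring_1 mat \<Rightarrow> nat" where
  "nilpotency_index A = (LEAST j. A ^\<^sub>m j = 0\<^sub>m (dim_row A) (dim_col A))"

end

theory Submission
  imports Defs
begin

text \<open>
  Regard \<open>\<langle>d, k, m\<rangle>\<close> as the partial translation \<open>i \<mapsto> i + d\<close> of the indices, defined for
  \<open>k \<le> i \<le> m\<close>. Its \<open>r\<close>-th power translates by \<open>r * d\<close> those \<open>i\<close> whose first \<open>r\<close> positions
  \<open>i, i + d, \<dots>, i + (r - 1) * d\<close> all lie in \<open>{k..m}\<close>. Such an \<open>i\<close> exists if and only if
  \<open>(r - 1) * \<bar>d\<bar> \<le> m - k\<close>; a witness is \<open>k\<close> for \<open>d \<ge> 0\<close> and \<open>m\<close> for \<open>d < 0\<close>.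
\<close>

lemma diag_segment_carrier: "diag_segment n d k m \<in> carrier_mat n n"
  by (simp add: diag_segment_def)

text \<open>Induction on \<open>r\<close>, peeling off the last factor: in the sum over the
  intermediate index only \<open>i + r * d\<close> can contribute.\<close>

lemma pow_diag_segment_index:
  assumes "1 \<le> k" "m \<le> n" "i < n" "j < n"
  shows "((diag_segment n d k m :: 'a :: semiring_1 mat) ^\<^sub>m r) $$ (i, j) =
    (if (\<forall>s<r. int k \<le> int i + 1 + int s * d \<and> int i + 1 + int s * d \<le> int m) \<and>
        int j - int i = int r * d then 1 else 0)"
  using assms(4)
proof (induction r arbitrary: j)
  case 0
  then show ?case
    using assms(3) by (auto simp: diag_segment_def)
next
  case (Suc r)
  let ?A = "diag_segment n d k m :: 'a mat"
  let ?l = "int i + int r * d"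
  let ?stay = "\<lambda>r. \<forall>s<r. int k \<le> int i + 1 + int s * d \<and> int i + 1 + int s * d \<le> int m"
  let ?in = "int k \<le> ?l + 1 \<and> ?l + 1 \<le> int m"
  have pow: "?A ^\<^sub>m r \<in> carrier_mat n n"
    by (intro pow_carrier_mat diag_segment_carrier)
  have "(?A ^\<^sub>m Suc r) $$ (i, j) = (\<Sum>l<n. (?A ^\<^sub>m r) $$ (i, l) * ?A $$ (l, j))"
    using pow diag_segment_carrier[of n d k m, where ?'a = 'a] assms(3) Suc.prems
    by (auto simp: scalar_prod_def lessThan_atLeast0 intro!: sum.cong)
  \<comment> \<open>If \<open>?l\<close> is negative, \<open>nat ?l\<close> is the default 0, but
    then \<open>?in\<close> fails because \<open>1 \<le> k\<close>. If \<open>?l \<ge> n\<close>, it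
    fails because \<open>m \<le> n\<close>.\<close>
  also have "\<dots> = (\<Sum>l<n. if l = nat ?l then
      (if ?stay r \<and> ?in \<and> int j - ?l = d then 1 else 0) else 0)"
  proof (intro sum.cong refl)
    fix l assume "l \<in> {..<n}"
    then have l: "l < n" by simp
    have A: "?A $$ (l, j) = (if k \<le> l + 1 \<and> l + 1 \<le> m \<and> int j - int l = d then 1 else 0)"
      using l Suc.prems by (simp add: diag_segment_def)
    have "l = nat ?l \<and> ?in \<longleftrightarrow> int l - int i = int r * d \<and> k \<le> l + 1 \<and> l + 1 \<le> m"
      using assms(1) by linarith
    moreover have "int j - ?l = d \<longleftrightarrow> int j - int l = d" if "int l - int i = int r * d"
      using that by linarith
    ultimately have conds: "l = nat ?l \<and> ?stay r \<and> ?in \<and> int j - ?l = d \<longleftrightarrow>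
        (?stay r \<and> int l - int i = int r * d) \<and> k \<le> l + 1 \<and> l + 1 \<le> m \<and> int j - int l = d"
      by blast
    have if_mult: "(if P then 1 else 0) * (if Q then 1 else 0) =
        (if R then if S then 1 else 0 else (0 :: 'a))"
      if "R \<and> S \<longleftrightarrow> P \<and> Q" for P Q R S
      using that by auto
    show "(?A ^\<^sub>m r) $$ (i, l) * ?A $$ (l, j) =
        (if l = nat ?l then (if ?stay r \<and> ?in \<and> int j - ?l = d then 1 else 0) else 0)"
      unfolding Suc.IH[OF l] A by (rule if_mult[OF conds])
  qed
  also have "\<dots> = (if ?stay r \<and> ?in \<and> int j - ?l = d then 1 else 0)"
    using assms(1,2) by (subst sum.delta) auto
  also have "?stay r \<and> ?in \<and> int j - ?l = d \<longleftrightarrow> ?stay (Suc r) \<and> int j - int i = int (Suc r) * d"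
    by (auto simp: less_Suc_eq algebra_simps)
  finally show ?case .
qed

lemma diag_paramsD:
  assumes "diag_params n d k m"
  shows "1 \<le> k" "k \<le> m" "m \<le> n" "int m - int k + 1 \<le> int n - \<bar>d\<bar>"
  using assms by (auto simp: diag_params_def min_def max_def split: if_splits)

text \<open>A walk with \<open>r\<close> positions in steps of \<open>d\<close> spans
  \<open>(r - 1) * \<bar>d\<bar>\<close>, and it fits into \<open>{k..m}\<close> exactly when this
  is at most \<open>m - k\<close>. For \<open>r = 0\<close> or \<open>d = 0\<close> both sides are
  false.\<close>

lemma pow_diag_segment_eq_zero_iff:
  assumes "diag_params n d k m"
  shows "(diag_segment n d k m :: 'a :: semiring_1 mat) ^\<^sub>m r = 0\<^sub>m n n \<longleftrightarrow>
    int m - int k < (int r - 1) * \<bar>d\<bar>"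
proof
  let ?A = "diag_segment n d k m :: 'a mat"
  note p = diag_paramsD[OF assms]
  note index = pow_diag_segment_index[OF p(1,3), where ?'a = 'a]
  {
    assume zero: "?A ^\<^sub>m r = 0\<^sub>m n n"
    show "int m - int k < (int r - 1) * \<bar>d\<bar>"
    proof (rule ccontr)
      assume "\<not> ?thesis"
      then have le: "(int r - 1) * \<bar>d\<bar> \<le> int m - int k" by simp
      have bound: "int s * \<bar>d\<bar> \<le> int m - int k" if "s < r" for s
        using mult_right_mono[of "int s" "int r - 1" "\<bar>d\<bar>"] that le by linarith
      \<comment> \<open>The end of \<open>{k..m}\<close> with the most room in direction
        \<open>d\<close>, shifted by 1 to the 0-based index.\<close>
      define i where "i = (if d \<ge> 0 then k - 1 else m - 1)"
      define j where "j = nat (int i + int r * d)"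
      have "i < n" using p by (auto simp: i_def)
      \<comment> \<open>The column \<open>j\<close> may lie outside the segment: one shift by
        \<open>d\<close> from a point of \<open>{k..m}\<close> still lands in \<open>{1..n}\<close>
        by \<open>diag_params\<close>.\<close>
      moreover have "0 \<le> int i + int r * d \<and> int i + int r * d < int n"
      proof (cases "d \<ge> 0")
        case True
        then have "0 \<le> int r * d" by simp
        with True show ?thesis
          using le p assms by (simp add: i_def diag_params_def left_diff_distrib)
      next
        case False
        then have "int r * d \<le> 0" by (simp add: mult_nonneg_nonpos)
        with False show ?thesis
          using le p assms by (simp add: i_def diag_params_def algebra_simps)
      qed
      then have "j < n" "int j - int i = int r * d"
        by (auto simp: j_def)
      moreover have "int k \<le> int i + 1 + int s * d \<and> int i + 1 + int s * d \<le> int m"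
        if "s < r" for s
      proof (cases "d \<ge> 0")
        case True
        then show ?thesis using bound[OF that] p by (simp add: i_def)
      next
        case False
        then have "int s * d \<le> 0" by (simp add: mult_nonneg_nonpos)
        with False show ?thesis using bound[OF that] p by (simp add: i_def)
      qed
      ultimately have "(?A ^\<^sub>m r) $$ (i, j) = 1"
        by (simp add: index)
      with zero \<open>i < n\<close> \<open>j < n\<close> show False by simp
    qed
  next
    assume lt: "int m - int k < (int r - 1) * \<bar>d\<bar>"
    then have "0 < (int r - 1) * \<bar>d\<bar>" using p by linarith
    then have r: "0 < r" by (cases r) (auto simp: zero_less_mult_iff)
    \<comment> \<open>The first and the last position, \<open>s = 0\<close> and
      \<open>s = r - 1\<close>, suffice: they are too far apart to lie both in
      \<open>{k..m}\<close>.\<close>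
    have escape: "\<not> (\<forall>s<r. int k \<le> int i + 1 + int s * d \<and> int i + 1 + int s * d \<le> int m)" for i
    proof
      assume *: "\<forall>s<r. int k \<le> int i + 1 + int s * d \<and> int i + 1 + int s * d \<le> int m"
      have "int k \<le> int i + 1" "int i + 1 \<le> int m"
        using *[rule_format, of 0] r by auto
      moreover have "int k \<le> int i + 1 + (int r - 1) * d" "int i + 1 + (int r - 1) * d \<le> int m"
        using *[rule_format, of "r - 1"] r by (auto simp: of_nat_diff)
      ultimately have "\<bar>(int r - 1) * d\<bar> \<le> int m - int k" by linarith
      with lt r show False by (simp add: abs_mult)
    qed
    have "?A ^\<^sub>m r \<in> carrier_mat n n"
      by (intro pow_carrier_mat diag_segment_carrier)
    then show "?A ^\<^sub>m r = 0\<^sub>m n n"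
      by (intro eq_matI) (auto simp: index escape)
  }
qed

text \<open>With \<open>d = 0\<close> both positions visited by the square equal \<open>i\<close>,
  so the formula for \<open>r = 2\<close> gives back the entries of the matrix.\<close>

lemma diag_segment_zero_idempotent:
  assumes "1 \<le> k" "m \<le> n"
  shows "idempotent_mat (diag_segment n 0 k m :: 'a :: semiring_1 mat)"
proof -
  let ?A = "diag_segment n 0 k m :: 'a mat"
  have A: "?A \<in> carrier_mat n n" by (rule diag_segment_carrier)
  have "?A ^\<^sub>m 2 = ?A"
  proof (rule eq_matI)
    fix i j assume "i < dim_row ?A" "j < dim_col ?A"
    then have "i < n" "j < n" using A by auto
    then show "(?A ^\<^sub>m 2) $$ (i, j) = ?A $$ (i, j)"
      unfolding pow_diag_segment_index[OF assms \<open>i < n\<close> \<open>j < n\<close>]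
      by (auto simp: diag_segment_def less_2_cases_iff)
  qed (use A in auto)
  then show ?thesis
    using A by (simp add: idempotent_mat_def numeral_2_eq_2)
qed

theorem theorem4:
  fixes n k m :: nat and d :: int and A :: "'a :: semiring_1 mat"
  assumes "n \<ge> 2"
    and "diag_params n d k m"
    and "A = diag_segment n d k m"
    and "A \<in> diag_monoid n - {0\<^sub>m n n}"
  shows "(d = 0 \<longrightarrow> idempotent_mat A) \<and>
         (d \<noteq> 0 \<longrightarrow>
            nilpotent_mat A \<and>
            int (nilpotency_index A) = 1 + \<lceil>(real m - real k + 1) / real_of_int \<bar>d\<bar>\<rceil> \<and>
            2 \<le> nilpotency_index A \<and> nilpotency_index A \<le> n)"
proof (intro conjI[of "d = 0 \<longrightarrow> _"] impI)
  note p = diag_paramsD[OF assms(2)]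
  show "idempotent_mat A" if "d = 0"
    using diag_segment_zero_idempotent[OF p(1,3)] that assms(3) by simp
  assume d: "d \<noteq> 0"
  define c where "c = \<lceil>(real m - real k + 1) / real_of_int \<bar>d\<bar>\<rceil>"
  \<comment> \<open>This turns the ceiling into the vanishing criterion for powers, with
    \<open>x = r - 1\<close>; the \<open>+ 1\<close> in the numerator makes the integer inequality
    strict.\<close>
  have c_le: "c \<le> x \<longleftrightarrow> int m - int k < x * \<bar>d\<bar>" for x
  proof -
    have "c \<le> x \<longleftrightarrow> real_of_int (int m - int k + 1) \<le> real_of_int (x * \<bar>d\<bar>)"
      using d by (simp add: c_def ceiling_le_iff pos_divide_le_eq)
    then show ?thesis unfolding of_int_le_iff by linarith
  qed
  have "\<not> c \<le> 0" using p by (simp add: c_le)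
  then have c: "1 \<le> c" by simp
  have dim: "dim_row A = n" "dim_col A = n"
    using diag_segment_carrier[of n d k m, where ?'a = 'a] assms(3) by auto
  have zero: "A ^\<^sub>m j = 0\<^sub>m n n \<longleftrightarrow> 1 + c \<le> int j" for j
    using pow_diag_segment_eq_zero_iff[OF assms(2), of j, where ?'a = 'a] c_le[of "int j - 1"]
    unfolding assms(3) by linarith
  have "nilpotency_index A = nat (1 + c)"
    unfolding nilpotency_index_def dim zero by (rule Least_equality) auto
  then have index: "int (nilpotency_index A) = 1 + c"
    using c by simp
  have "1 \<le> \<bar>d\<bar>" using d by linarith
  \<comment> \<open>The diagonal has \<open>n - \<bar>d\<bar>\<close> entries, hence at most
    \<open>n - 1\<close>. This gives the upper bound \<open>n\<close> on the index; the lower bound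
    2 comes from \<open>1 \<le> c\<close>.\<close>
  with p(4) have "int m - int k < (int n - 1) * 1" by simp
  also have "\<dots> \<le> (int n - 1) * \<bar>d\<bar>"
    using d assms(1) by (intro mult_left_mono) auto
  finally have "c \<le> int n - 1"
    unfolding c_le .
  moreover have "nilpotent_mat A"
    unfolding nilpotent_mat_def dim zero by (intro exI[of _ "nat (1 + c)"]) auto
  ultimately show "nilpotent_mat A \<and>
      int (nilpotency_index A) = 1 + \<lceil>(real m - real k + 1) / real_of_int \<bar>d\<bar>\<rceil> \<and>
      2 \<le> nilpotency_index A \<and> nilpotency_index A \<le> n"
    using index c unfolding c_def by linarith
qed

end
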